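(* Let $A\in M_2(\mathbb{C})\setminus\{0\}$ and let $$P(x,y,t)=c_0(x,y)+c_1(x,y)\,t+c_2(x,y)\,t^2+c_3(x,y)\,t^3+c_4(x,y)\,t^4,$$ where $$c_0=a_{10},\quad c_1=a_7x+a_8y,\quad c_2=a_1x^2+a_2y^2+a_4xy+a_9,\quad c_3=a_5x+a_6y,\quad c_4=a_3,$$ with $$\begin{array}{l} a_1=\operatorname{tr}(A^*A)+2\operatorname{Re}(\det A),\quad a_2=\operatorname{tr}(A^*A)-2\operatorname{Re}(\det A),\quad a_3=1,\quad a_4=4\operatorname{Im}(\det A),\\ a_5=-2\operatorname{Re}(\operatorname{tr}A),\quad a_6=-2\operatorname{Im}(\operatorname{tr}A),\quad a_7=-2\operatorname{Re}(\det A\,\operatorname{tr}A^* ),\quad a_8=-2\operatorname{Im}(\det A\,\operatorname{tr}A^* ),\\ a_9=|\operatorname{tr}A|^2-\operatorname{tr}(A^*A),\quad a_{10}=|\det A|^2.\end{array}$$ Then $F_N(A)$ is the union of the family of ellipses $$E(t)=\{x+iy:(x,y)\in\mathbb{R}^2,\ P(x,y,t)=0\}$$ indexed by $t$ with $\sigma_1\le t\le\sigma_2$ and $t\neq0$, where $\sigma_1\le\sigma_2$ are the singular values of $A$.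
   Context: $M_n(\mathbb{C})$ is the algebra of $n\times n$ complex matrices. The normalized numerical range of $A\in M_n(\mathbb{C})$ is $F_N(A)=\{x^*Ax/(\|x\|\|Ax\|): x\in\mathbb{C}^n,\ Ax\neq0\}$.
   Formalization: If σ₁ = σ₂ = σ, E(σ) is an entire line (for A = I it is x = 1 while F_N(A) = {1}), so the claim fails as written; in that case E(t) is replaced by its intersection with the closed unit disc. Ellipses may be degenerate (points or segments). *)

theory Defs
  imports "HOL-Analysis.Analysis" "HOL-Library.Multiset"
begin

definition adj :: "complex^'n^'m \<Rightarrow> complex^'m^'n" where
  "adj A = (\<chi> i j. cnj (A $ j $ i))"

text \<open>The product \<open>x\<^sup>* y\<close>, conjugate-linear in the first argument.\<close>
definition cdot :: "complex^'n \<Rightarrow> complex^'n \<Rightarrow> complex" where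
  "cdot x y = (\<Sum>i\<in>UNIV. cnj (x $ i) * y $ i)"

definition normalized_numerical_range :: "complex^'n^'n \<Rightarrow> complex set" where
  "normalized_numerical_range A =
     {cdot x (A *v x) / complex_of_real (norm x * norm (A *v x)) | x. A *v x \<noteq> 0}"

text \<open>The singular values are the square roots of the eigenvalues of \<open>A\<^sup>* A\<close>, counted with
  multiplicity as roots of its characteristic polynomial; this determines \<open>M\<close> uniquely.\<close>
definition has_singular_values :: "complex^'n^'n \<Rightarrow> real multiset \<Rightarrow> bool" where
  "has_singular_values A M \<longleftrightarrow>
     (\<forall>s\<in>#M. 0 \<le> s) \<and>
     (\<forall>z. det (mat z - adj A ** A) = (\<Prod>s\<in>#M. z - complex_of_real (s\<^sup>2)))"

definition P :: "complex^2^2 \<Rightarrow> real \<Rightarrow> real \<Rightarrow> real \<Rightarrow> real" where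
  "P A x y t =
    (let a1 = Re (trace (adj A ** A)) + 2 * Re (det A);
         a2 = Re (trace (adj A ** A)) - 2 * Re (det A);
         a3 = 1;
         a4 = 4 * Im (det A);
         a5 = - 2 * Re (trace A);
         a6 = - 2 * Im (trace A);
         a7 = - 2 * Re (det A * trace (adj A));
         a8 = - 2 * Im (det A * trace (adj A));
         a9 = (cmod (trace A))\<^sup>2 - Re (trace (adj A ** A));
         a10 = (cmod (det A))\<^sup>2;
         c0 = a10;
         c1 = a7 * x + a8 * y;
         c2 = a1 * x\<^sup>2 + a2 * y\<^sup>2 + a4 * x * y + a9;
         c3 = a5 * x + a6 * y;
         c4 = a3
     in c0 + c1 * t + c2 * t ^ 2 + c3 * t ^ 3 + c4 * t ^ 4)"

definition E :: "complex^2^2 \<Rightarrow> real \<Rightarrow> complex set" where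
  "E A t = {Complex x y | x y. P A x y t = 0}"

text \<open>An ellipse is the image of the unit circle under a real affine map of the plane.  Degenerate
  ellipses, i.e. line segments and single points, are included: if the singular values
  \<open>\<sigma>\<^sub>1 < \<sigma>\<^sub>2\<close> are distinct, then \<open>E A \<sigma>\<^sub>2\<close> is a single point.
  If \<open>\<sigma>\<^sub>1 = \<sigma>\<^sub>2 = \<sigma>\<close>, so that \<open>A\<close> is \<open>\<sigma>\<close> times a unitary matrix, the quadratic part of
  \<open>P A x y \<sigma>\<close> has rank one and \<open>E A \<sigma>\<close> is a whole line (for the identity matrix,
  \<open>P A x y 1 = 4 (x - 1)\<^sup>2\<close>); the degenerate ellipse is then the part of this line lying in the
  closed unit disc.\<close>
definition ellipse :: "complex set \<Rightarrow> bool" where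
  "ellipse S \<longleftrightarrow> (\<exists>c p q. S = {c + cos \<theta> *\<^sub>R p + sin \<theta> *\<^sub>R q | \<theta>::real. True})"

end

theory Submission
  imports Defs
begin

text \<open>
  Both sides of the claim are invariant under unitary similarity: the quartic \<open>P\<close> involves \<open>A\<close>
  only through \<open>trace A\<close>, \<open>det A\<close> and \<open>trace (A\<^sup>* A)\<close>.  In an orthonormal basis of eigenvectors of
  \<open>A\<^sup>* A\<close> the columns of the matrix are orthogonal with norms \<open>s\<^sub>1, s\<^sub>2\<close>, the singular values, so it
  has the form \<open>\<omega> W diag(s\<^sub>1, s\<^sub>2)\<close> with \<open>|\<omega>| = 1\<close> and \<open>W\<close> in \<open>SU(2)\<close> with first column
  \<open>(u, v)\<close> (\<open>unitarily_similar_to_polar_form\<close>).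

  For such a matrix both sides can be computed in the coordinate \<open>\<zeta> = X + i Y\<close> with
  \<open>z = \<omega> \<zeta>\<close>.  The quartic becomes (\<open>P_polar_form\<close>)
  \<open>P = ((s\<^sub>1 + s\<^sub>2) t X - (t\<^sup>2 + s\<^sub>1 s\<^sub>2) Re u)\<^sup>2 + ((s\<^sub>2 - s\<^sub>1) t Y - (s\<^sub>1 s\<^sub>2 - t\<^sup>2) Im u)\<^sup>2
        - |v|\<^sup>2 (t\<^sup>2 - s\<^sub>1\<^sup>2) (s\<^sub>2\<^sup>2 - t\<^sup>2)\<close>,
  so for \<open>s\<^sub>1 < s\<^sub>2\<close> its zero set is an ellipse with axes in the directions \<open>\<omega>\<close> and \<open>i \<omega>\<close>.
  On the other side, a unit vector \<open>(x\<^sub>1, x\<^sub>2)\<close> contributes with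
  \<open>t\<^sup>2 = s\<^sub>1\<^sup>2 |x\<^sub>1|\<^sup>2 + s\<^sub>2\<^sup>2 |x\<^sub>2|\<^sup>2\<close>, and its value of \<open>\<zeta>\<close> is an affine function of the real and imaginary
  parts of \<open>g = v x\<^sub>1 cnj x\<^sub>2\<close>
  (\<open>mem_normalized_numerical_range_polar_form\<close>).  Substituting it into the displayed formula, the two
  squares become \<open>(s\<^sub>2\<^sup>2 - s\<^sub>1\<^sup>2)\<^sup>2 |g|\<^sup>2\<close>, and \<open>P = 0\<close> amounts to \<open>|g| = |v| |x\<^sub>1| |x\<^sub>2|\<close>.  If \<open>s\<^sub>1 < s\<^sub>2\<close>, then
  conversely \<open>t\<close> fixes \<open>|x\<^sub>1|\<close> and \<open>|x\<^sub>2|\<close>, the point \<open>\<zeta>\<close> fixes \<open>g\<close>, and \<open>P = 0\<close> makes this \<open>g\<close> attainable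
  by a choice of phases.

  If \<open>s\<^sub>1 = s\<^sub>2\<close>, then \<open>g\<close> can no longer be recovered and \<open>P = 0\<close> is the line \<open>X = Re u\<close>.  The
  normalized numerical range lies on it and, by the Cauchy-Schwarz inequality, in the closed unit disc;
  an explicit one-parameter family of unit vectors sweeps out the whole chord.
\<close>

section \<open>Adjoints and the inner product\<close>

lemma adj_adj [simp]: "adj (adj A) = A"
  by (simp add: adj_def vec_eq_iff)

lemma adj_matrix_mul: "adj (A ** B) = adj B ** adj A"
  by (simp add: adj_def matrix_matrix_mult_def vec_eq_iff mult.commute)

lemma trace_adj: "trace (adj A) = cnj (trace A)"
  by (simp add: trace_def adj_def)

lemma cdot_matrix_vector_mult: "cdot x (A *v y) = cdot (adj A *v x) y"
proof -
  have "cdot x (A *v y) = (\<Sum>i\<in>UNIV. \<Sum>j\<in>UNIV. cnj (x $ i) * (A $ i $ j * y $ j))"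
    by (simp add: cdot_def matrix_vector_mult_def sum_distrib_left)
  also have "\<dots> = (\<Sum>j\<in>UNIV. \<Sum>i\<in>UNIV. cnj (x $ i) * (A $ i $ j * y $ j))"
    by (rule sum.swap)
  also have "\<dots> = cdot (adj A *v x) y"
    by (simp add: cdot_def matrix_vector_mult_def adj_def sum_distrib_left sum_distrib_right mult_ac)
  finally show ?thesis .
qed

lemma cdot_self: "cdot x x = complex_of_real ((norm x)\<^sup>2)"
proof -
  have "(norm x)\<^sup>2 = (\<Sum>i\<in>UNIV. (cmod (x $ i))\<^sup>2)"
    by (simp add: norm_vec_def L2_set_def sum_nonneg)
  then show ?thesis
    by (simp only: cdot_def of_real_sum complex_norm_square mult.commute)
qed

lemma cdot_Cauchy_Schwarz: "cmod (cdot x y) \<le> norm x * norm y"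
proof -
  have "cmod (cdot x y) \<le> (\<Sum>i\<in>UNIV. cmod (x $ i) * cmod (y $ i))"
    unfolding cdot_def by (rule order_trans[OF norm_sum]) (simp add: norm_mult)
  also have "\<dots> \<le> norm x * norm y"
    using L2_set_mult_ineq[of "\<lambda>i. cmod (x $ i)" "\<lambda>i. cmod (y $ i)" UNIV]
    by (simp add: norm_vec_def)
  finally show ?thesis .
qed

section \<open>The normalized numerical range lies in the closed unit disc\<close>

lemma normalized_numerical_range_unit:
  "normalized_numerical_range A =
     {cdot x (A *v x) / complex_of_real (norm (A *v x)) | x. norm x = 1 \<and> A *v x \<noteq> 0}"
  (is "_ = ?R")
proof
  show "?R \<subseteq> normalized_numerical_range A"
    by (force simp: normalized_numerical_range_def)
  show "normalized_numerical_range A \<subseteq> ?R"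
  proof
    fix z assume "z \<in> normalized_numerical_range A"
    then obtain x where nz: "A *v x \<noteq> 0"
      and z: "z = cdot x (A *v x) / complex_of_real (norm x * norm (A *v x))"
      by (auto simp: normalized_numerical_range_def)
    then have x: "norm x \<noteq> 0" by auto
    define y where "y = (1 / norm x) *\<^sub>R x"
    have y: "y = complex_of_real (1 / norm x) *s x"
      by (simp add: y_def vec_eq_iff scaleR_conv_of_real[where 'a = complex])
    have Ay: "A *v y = complex_of_real (1 / norm x) *s (A *v x)"
      unfolding y by (rule vector_scalar_commute)
    have Ay': "A *v y = (1 / norm x) *\<^sub>R (A *v x)"
      by (simp add: Ay vec_eq_iff scaleR_conv_of_real[where 'a = complex])
    have "cdot y (A *v y) = cdot x (A *v x) / of_real ((norm x)\<^sup>2)"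
      unfolding y Ay[unfolded y]
      by (simp add: cdot_def sum_divide_distrib power2_eq_square mult_ac)
    moreover have "norm (A *v y) = norm (A *v x) / norm x" by (simp add: Ay')
    moreover have "norm y = 1" using x by (simp add: y_def)
    moreover have "A *v y \<noteq> 0" using nz x by (simp add: Ay')
    ultimately show "z \<in> ?R"
      using x by (intro CollectI exI[of _ y]) (simp add: z power2_eq_square)
  qed
qed

text \<open>This bound is what cuts the line \<open>E A \<sigma>\<close> down to a segment when both singular values
  equal \<open>\<sigma>\<close>.\<close>
lemma normalized_numerical_range_subset_cball:
  "normalized_numerical_range A \<subseteq> cball 0 1"
proof
  fix z assume "z \<in> normalized_numerical_range A"
  then obtain x where "z = cdot x (A *v x) / complex_of_real (norm x * norm (A *v x))"
    by (auto simp: normalized_numerical_range_def)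
  then have "cmod z = cmod (cdot x (A *v x)) / (norm x * norm (A *v x))"
    by (simp only: norm_divide norm_of_real abs_mult abs_norm_cancel)
  also have "\<dots> \<le> 1"
    using cdot_Cauchy_Schwarz[of x "A *v x"] by (intro divide_le_eq_1[THEN iffD2]) (auto simp: less_le)
  finally show "z \<in> cball 0 1" by simp
qed

section \<open>Invariance under unitary similarity\<close>

lemma norm_unitary_mult:
  assumes "adj V ** V = mat 1"
  shows "norm (V *v x) = norm x"
proof -
  have "complex_of_real ((norm (V *v x))\<^sup>2) = complex_of_real ((norm x)\<^sup>2)"
    unfolding cdot_self[symmetric]
    by (simp add: cdot_matrix_vector_mult matrix_vector_mul_assoc assms)
  then show ?thesis
    by (metis norm_ge_zero of_real_eq_iff power2_eq_iff_nonneg)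
qed

lemma unitary_right_inverse:
  fixes V :: "complex^'n^'n"
  assumes "adj V ** V = mat 1"
  shows "V ** adj V = mat 1"
  using assms matrix_left_right_inverse by blast

lemma normalized_numerical_range_unitary_similar_subset:
  fixes A V :: "complex^'n^'n"
  assumes V: "adj V ** V = mat 1"
  shows "normalized_numerical_range (adj V ** A ** V) \<subseteq> normalized_numerical_range A"
proof
  fix z assume "z \<in> normalized_numerical_range (adj V ** A ** V)"
  then obtain x where nz: "(adj V ** A ** V) *v x \<noteq> 0"
    and z: "z = cdot x ((adj V ** A ** V) *v x) /
        complex_of_real (norm x * norm ((adj V ** A ** V) *v x))"
    by (auto simp: normalized_numerical_range_def)
  have V': "adj (adj V) ** adj V = mat 1"
    using unitary_right_inverse[OF V] by simp
  have eq: "(adj V ** A ** V) *v x = adj V *v (A *v (V *v x))"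
    by (simp add: matrix_vector_mul_assoc matrix_mul_assoc)
  have "A *v (V *v x) \<noteq> 0" using nz eq by auto
  moreover have "norm ((adj V ** A ** V) *v x) = norm (A *v (V *v x))"
    unfolding eq by (rule norm_unitary_mult[OF V'])
  moreover have "cdot x ((adj V ** A ** V) *v x) = cdot (V *v x) (A *v (V *v x))"
    by (simp add: eq cdot_matrix_vector_mult[of x "adj V"])
  ultimately show "z \<in> normalized_numerical_range A"
    unfolding normalized_numerical_range_def using z norm_unitary_mult[OF V, of x]
    by (intro CollectI exI[of _ "V *v x"]) simp
qed

text \<open>Every unitary similarity is undone by another one, with \<open>adj V\<close> in place of \<open>V\<close>,
  so the inclusion just proved gives both directions.\<close>
lemma normalized_numerical_range_unitary_similar:
  fixes A V :: "complex^'n^'n"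
  assumes V: "adj V ** V = mat 1"
  shows "normalized_numerical_range (adj V ** A ** V) = normalized_numerical_range A"
proof
  show "normalized_numerical_range (adj V ** A ** V) \<subseteq> normalized_numerical_range A"
    using V by (rule normalized_numerical_range_unitary_similar_subset)
  have V': "V ** adj V = mat 1" using V by (rule unitary_right_inverse)
  have "adj (adj V) ** (adj V ** A ** V) ** adj V = (V ** adj V) ** A ** (V ** adj V)"
    by (simp add: matrix_mul_assoc)
  also have "\<dots> = A" by (simp add: V')
  finally show "normalized_numerical_range A \<subseteq> normalized_numerical_range (adj V ** A ** V)"
    using normalized_numerical_range_unitary_similar_subset[of "adj V" "adj V ** A ** V"] V' by simp
qed

lemma trace_unitary_similar:
  fixes A V :: "complex^'n^'n"
  assumes "adj V ** V = mat 1"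
  shows "trace (adj V ** A ** V) = trace A"
  by (metis assms matrix_mul_assoc matrix_mul_rid trace_mul_sym unitary_right_inverse)

lemma det_unitary_similar:
  fixes A V :: "complex^'n^'n"
  assumes "adj V ** V = mat 1"
  shows "det (adj V ** A ** V) = det A"
  by (metis assms det_I det_mul mult.commute mult.right_neutral mult.assoc)

lemma adj_unitary_similar: "adj (adj V ** A ** V) = adj V ** adj A ** V"
  by (simp add: adj_matrix_mul matrix_mul_assoc)

lemma gram_unitary_similar:
  fixes A V :: "complex^'n^'n"
  assumes "adj V ** V = mat 1"
  shows "adj (adj V ** A ** V) ** (adj V ** A ** V) = adj V ** (adj A ** A) ** V"
proof -
  have "adj (adj V ** A ** V) ** (adj V ** A ** V) = adj V ** adj A ** (V ** adj V) ** A ** V"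
    by (simp add: adj_unitary_similar matrix_mul_assoc)
  then show ?thesis
    by (simp add: unitary_right_inverse[OF assms] matrix_mul_assoc)
qed

text \<open>The quartic sees \<open>A\<close> only through \<open>trace A\<close>, \<open>det A\<close> and \<open>trace (A\<^sup>* A)\<close>, all of
  which are unitary invariants.\<close>
lemma P_unitary_similar:
  assumes "adj V ** V = mat 1"
  shows "P (adj V ** A ** V) = P A"
  unfolding P_def gram_unitary_similar[OF assms] unfolding adj_unitary_similar
    trace_unitary_similar[OF assms] det_unitary_similar[OF assms] ..

lemma E_unitary_similar:
  assumes "adj V ** V = mat 1"
  shows "E (adj V ** A ** V) = E A"
  using P_unitary_similar[OF assms, of A] by (simp add: E_def fun_eq_iff)

section \<open>Singular values and reduction to a polar form\<close>

lemma eigenvector_of_det_zero: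
  fixes H :: "complex^'n^'n"
  assumes "det (mat s - H) = 0"
  obtains e where "norm e = 1" "H *v e = s *s e"
proof -
  have "\<not> invertible (mat s - H)" using assms by (simp add: invertible_det_nz)
  then obtain x where x: "(mat s - H) *v x = 0" "x \<noteq> 0"
    by (metis invertible_def matrix_left_invertible_ker matrix_left_right_inverse)
  define e where "e = complex_of_real (1 / norm x) *s x"
  have ms: "mat s *v y = s *s y" for y :: "complex^'n"
    by (simp add: vec_eq_iff matrix_vector_mult_def mat_def if_distrib if_distribR cong: if_cong)
  have "H *v x = s *s x" using x(1) by (simp add: matrix_vector_mult_diff_rdistrib ms)
  then have "H *v e = s *s e"
    by (simp add: e_def vector_scalar_commute vector_smult_assoc mult.commute)
  moreover have "e = (1 / norm x) *\<^sub>R x"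
    unfolding e_def by (simp add: vec_eq_iff scaleR_conv_of_real[where 'a = complex])
  then have "norm e = 1" using x(2) by simp
  ultimately show ?thesis using that by blast
qed

text \<open>The matrix \<open>\<omega> W diag(s\<^sub>1, s\<^sub>2)\<close> with \<open>W\<close> the matrix of \<open>SU(2)\<close> whose first column is
  \<open>(u, v)\<close>, when \<open>|u|\<^sup>2 + |v|\<^sup>2 = 1\<close>.  Splitting the phase \<open>\<omega>\<close> off the unitary factor is what
  later turns all the ellipses into rotated copies, by the same \<open>\<omega>\<close>, of axis-parallel ones.\<close>
definition polar_form :: "complex \<Rightarrow> complex \<Rightarrow> complex \<Rightarrow> real \<Rightarrow> real \<Rightarrow> complex^2^2" where
  "polar_form \<omega> u v s\<^sub>1 s\<^sub>2 =
     vector [vector [\<omega> * of_real s\<^sub>1 * u, - (\<omega> * of_real s\<^sub>2 * cnj v)],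
             vector [\<omega> * of_real s\<^sub>1 * v, \<omega> * of_real s\<^sub>2 * cnj u]]"

lemma polar_form_nth [simp]:
  "polar_form \<omega> u v s\<^sub>1 s\<^sub>2 $ 1 $ 1 = \<omega> * of_real s\<^sub>1 * u"
  "polar_form \<omega> u v s\<^sub>1 s\<^sub>2 $ 1 $ 2 = - (\<omega> * of_real s\<^sub>2 * cnj v)"
  "polar_form \<omega> u v s\<^sub>1 s\<^sub>2 $ 2 $ 1 = \<omega> * of_real s\<^sub>1 * v"
  "polar_form \<omega> u v s\<^sub>1 s\<^sub>2 $ 2 $ 2 = \<omega> * of_real s\<^sub>2 * cnj u"
  by (simp_all add: polar_form_def)

text \<open>Let \<open>(p, q)\<close> be the normalized second column.  In dimension two the first column,
  being orthogonal to it, is a multiple \<open>l (cnj q, - cnj p)\<close> with \<open>|l| = s\<^sub>1\<close>.  If \<open>\<omega>\<^sup>2\<close> is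
  the phase of \<open>l\<close>, then the unitary factor with columns \<open>\<omega>\<^sup>2 (cnj q, - cnj p)\<close> and \<open>(p, q)\<close> has
  determinant \<open>\<omega>\<^sup>2\<close>, so dividing it by \<open>\<omega>\<close> gives an element of \<open>SU(2)\<close>.
  Only the second column has to be normalized, so \<open>s\<^sub>1 = 0\<close> is harmless.\<close>
lemma polar_form_of_orthogonal_columns:
  fixes B :: "complex^2^2"
  assumes s: "0 \<le> s\<^sub>1" "0 < s\<^sub>2"
    and c1: "(cmod (B $ 1 $ 1))\<^sup>2 + (cmod (B $ 2 $ 1))\<^sup>2 = s\<^sub>1\<^sup>2"
    and c2: "(cmod (B $ 1 $ 2))\<^sup>2 + (cmod (B $ 2 $ 2))\<^sup>2 = s\<^sub>2\<^sup>2"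
    and orth: "cnj (B $ 1 $ 2) * B $ 1 $ 1 + cnj (B $ 2 $ 2) * B $ 2 $ 1 = 0"
  obtains \<omega> u v where "cmod \<omega> = 1" "(cmod u)\<^sup>2 + (cmod v)\<^sup>2 = 1" "B = polar_form \<omega> u v s\<^sub>1 s\<^sub>2"
proof -
  define p where "p = B $ 1 $ 2 / of_real s\<^sub>2"
  define q where "q = B $ 2 $ 2 / of_real s\<^sub>2"
  have B2: "B $ 1 $ 2 = of_real s\<^sub>2 * p" "B $ 2 $ 2 = of_real s\<^sub>2 * q"
    using s by (auto simp: p_def q_def)
  have pq: "(cmod p)\<^sup>2 + (cmod q)\<^sup>2 = 1"
    using c2 s by (simp add: p_def q_def norm_divide power_divide add_divide_distrib[symmetric])
  have pq': "p * cnj p + q * cnj q = 1"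
    using pq by (metis complex_norm_square of_real_1 of_real_add of_real_power)
  \<comment> \<open>The coordinate of the first column along the unit vector \<open>(cnj q, - cnj p)\<close>.\<close>
  define l where "l = q * B $ 1 $ 1 - p * B $ 2 $ 1"
  have orth': "cnj p * B $ 1 $ 1 + cnj q * B $ 2 $ 1 = 0"
  proof -
    have "of_real s\<^sub>2 * (cnj p * B $ 1 $ 1 + cnj q * B $ 2 $ 1) = 0"
      using orth by (simp add: B2 algebra_simps)
    then show ?thesis using s by simp
  qed
  have B1: "B $ 1 $ 1 = l * cnj q" "B $ 2 $ 1 = - (l * cnj p)"
  proof -
    have "l * cnj q = B $ 1 $ 1 * (p * cnj p + q * cnj q) - p * (cnj p * B $ 1 $ 1 + cnj q * B $ 2 $ 1)"
      by (simp add: l_def algebra_simps)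
    then show "B $ 1 $ 1 = l * cnj q" by (simp add: pq' orth')
    have "- (l * cnj p) = B $ 2 $ 1 * (p * cnj p + q * cnj q) - q * (cnj p * B $ 1 $ 1 + cnj q * B $ 2 $ 1)"
      by (simp add: l_def algebra_simps)
    then show "B $ 2 $ 1 = - (l * cnj p)" by (simp add: pq' orth')
  qed
  have "(cmod l)\<^sup>2 * ((cmod p)\<^sup>2 + (cmod q)\<^sup>2) = s\<^sub>1\<^sup>2"
    using c1 by (simp add: B1 norm_mult power_mult_distrib algebra_simps)
  then have l: "cmod l = s\<^sub>1" using pq s by (simp add: power2_eq_iff_nonneg)
  define \<omega> where "\<omega> = cis (Arg l / 2)"
  have \<omega>: "\<omega> * \<omega> * of_real s\<^sub>1 = l"
    using rcis_cmod_Arg[of l] by (simp add: \<omega>_def cis_mult rcis_def l mult.commute)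
  have \<omega>1: "cmod \<omega> = 1" by (simp add: \<omega>_def)
  have \<omega>c: "\<omega> * cnj \<omega> = 1" by (simp add: \<omega>_def cis_cnj cis_mult)
  have "B = polar_form \<omega> (\<omega> * cnj q) (- (\<omega> * cnj p)) s\<^sub>1 s\<^sub>2"
    unfolding vec_eq_iff forall_2 using \<omega> \<omega>c
    by (simp add: B1 B2) (simp add: algebra_simps flip: \<omega>)
  moreover have "(cmod (\<omega> * cnj q))\<^sup>2 + (cmod (- (\<omega> * cnj p)))\<^sup>2 = 1"
    using pq \<omega>1 by (simp add: norm_mult)
  ultimately show ?thesis using that \<omega>1 by blast
qed

text \<open>The trace is read off by comparing the characteristic polynomial with its
  factorization at the two points \<open>0\<close> and \<open>1\<close>.\<close>
lemma trace_gram_singular_values: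
  fixes A :: "complex^2^2"
  assumes "has_singular_values A {#s\<^sub>1, s\<^sub>2#}"
  shows "trace (adj A ** A) = of_real (s\<^sub>1\<^sup>2 + s\<^sub>2\<^sup>2)"
proof -
  define H where "H = adj A ** A"
  have char: "\<And>z. det (mat z - H) = (z - of_real (s\<^sub>1\<^sup>2)) * (z - of_real (s\<^sub>2\<^sup>2))"
    using assms by (auto simp: has_singular_values_def H_def)
  show ?thesis
    using char[of 0] char[of 1] unfolding H_def[symmetric]
    by (simp add: det_2 mat_def trace_def sum_2 algebra_simps)
qed

lemma larger_singular_value_pos:
  fixes A :: "complex^2^2"
  assumes "has_singular_values A {#s\<^sub>1, s\<^sub>2#}" "s\<^sub>1 \<le> s\<^sub>2" "A \<noteq> 0"
  shows "0 < s\<^sub>2"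
proof (rule ccontr)
  assume "\<not> 0 < s\<^sub>2"
  then have "s\<^sub>1 = 0" "s\<^sub>2 = 0" using assms by (auto simp: has_singular_values_def)
  then have "trace (adj A ** A) = 0" using trace_gram_singular_values[OF assms(1)] by simp
  moreover have "trace (adj A ** A) = of_real ((cmod (A $ 1 $ 1))\<^sup>2 + (cmod (A $ 2 $ 1))\<^sup>2
      + (cmod (A $ 1 $ 2))\<^sup>2 + (cmod (A $ 2 $ 2))\<^sup>2)"
    unfolding of_real_add complex_norm_square
    by (simp add: trace_def adj_def matrix_matrix_mult_def sum_2 mult.commute)
  ultimately have "(cmod (A $ 1 $ 1))\<^sup>2 + (cmod (A $ 2 $ 1))\<^sup>2
      + (cmod (A $ 1 $ 2))\<^sup>2 + (cmod (A $ 2 $ 2))\<^sup>2 = 0"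
    by (metis of_real_eq_0_iff)
  then have "A = 0"
    by (simp add: vec_eq_iff forall_2 add_nonneg_eq_0_iff)
  with assms(3) show False by contradiction
qed

text \<open>An orthonormal basis of eigenvectors of \<open>A\<^sup>* A\<close> makes the columns of the transformed
  matrix orthogonal with norms \<open>s\<^sub>1\<close> and \<open>s\<^sub>2\<close>.  A unit eigenvector \<open>e\<close> for \<open>s\<^sub>1\<^sup>2\<close> determines such a basis; the
  remaining diagonal entry is \<open>s\<^sub>2\<^sup>2\<close> because the trace is known.\<close>
lemma unitarily_similar_to_polar_form:
  fixes A :: "complex^2^2"
  assumes "has_singular_values A {#s\<^sub>1, s\<^sub>2#}" and s2: "0 < s\<^sub>2"
  obtains V \<omega> u v where "adj V ** V = mat 1" "cmod \<omega> = 1" "(cmod u)\<^sup>2 + (cmod v)\<^sup>2 = 1"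
    "adj V ** A ** V = polar_form \<omega> u v s\<^sub>1 s\<^sub>2"
proof -
  define H where "H = adj A ** A"
  have s1: "0 \<le> s\<^sub>1"
    and char: "\<And>z. det (mat z - H) = (z - of_real (s\<^sub>1\<^sup>2)) * (z - of_real (s\<^sub>2\<^sup>2))"
    using assms(1) by (auto simp: has_singular_values_def H_def)
  have "det (mat (of_real (s\<^sub>1\<^sup>2)) - H) = 0" by (simp add: char)
  then obtain e where e: "norm e = 1" "H *v e = of_real (s\<^sub>1\<^sup>2) *s e"
    by (rule eigenvector_of_det_zero)
  have tr: "trace H = of_real (s\<^sub>1\<^sup>2 + s\<^sub>2\<^sup>2)"
    unfolding H_def by (rule trace_gram_singular_values[OF assms(1)])
  \<comment> \<open>The second column is the unit vector orthogonal to \<open>e\<close>, unique up to a phase.\<close>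
  define V :: "complex^2^2" where
    "V = vector [vector [e $ 1, - cnj (e $ 2)], vector [e $ 2, cnj (e $ 1)]]"
  have en: "cnj (e $ 1) * e $ 1 + cnj (e $ 2) * e $ 2 = 1"
    using cdot_self[of e] e(1) by (simp add: cdot_def sum_2)
  have V: "adj V ** V = mat 1"
    using en by (simp add: vec_eq_iff forall_2 adj_def matrix_matrix_mult_def mat_def V_def sum_2
        algebra_simps)
  define B where "B = adj V ** A ** V"
  define G where "G = adj B ** B"
  have G: "G = adj V ** H ** V"
    unfolding G_def B_def H_def by (rule gram_unitary_similar[OF V])
  have Ve: "V *v axis 1 1 = e"
    by (simp add: vec_eq_iff forall_2 matrix_vector_mult_def axis_def V_def sum_2)
  have "G *v axis 1 1 = adj V *v (H *v e)"
    by (simp add: G matrix_vector_mul_assoc[symmetric] Ve)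
  also have "\<dots> = of_real (s\<^sub>1\<^sup>2) *s ((adj V ** V) *v axis 1 1)"
    by (simp only: e(2) vector_scalar_commute matrix_vector_mul_assoc[symmetric] Ve)
  finally have G1: "G *v axis 1 1 = of_real (s\<^sub>1\<^sup>2) *s axis 1 1" by (simp add: V)
  have G11: "G $ 1 $ 1 = of_real (s\<^sub>1\<^sup>2)" and G21: "G $ 2 $ 1 = 0"
    using G1 by (simp_all add: vec_eq_iff forall_2 matrix_vector_mult_def axis_def sum_2)
  have "trace G = trace H" unfolding G by (rule trace_unitary_similar[OF V])
  then have G22: "G $ 2 $ 2 = of_real (s\<^sub>2\<^sup>2)"
    using G11 tr by (simp add: trace_def sum_2)
  have Gd: "G $ i $ i = of_real ((cmod (B $ 1 $ i))\<^sup>2 + (cmod (B $ 2 $ i))\<^sup>2)" for i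
    by (simp only: G_def adj_def matrix_matrix_mult_def sum_2 complex_norm_square of_real_add vec_lambda_beta mult.commute)
  have c1: "(cmod (B $ 1 $ 1))\<^sup>2 + (cmod (B $ 2 $ 1))\<^sup>2 = s\<^sub>1\<^sup>2"
    using G11 Gd[of 1] by (metis of_real_eq_iff)
  have c2: "(cmod (B $ 1 $ 2))\<^sup>2 + (cmod (B $ 2 $ 2))\<^sup>2 = s\<^sub>2\<^sup>2"
    using G22 Gd[of 2] by (metis of_real_eq_iff)
  have orth: "cnj (B $ 1 $ 2) * B $ 1 $ 1 + cnj (B $ 2 $ 2) * B $ 2 $ 1 = 0"
    using G21 by (simp add: G_def adj_def matrix_matrix_mult_def sum_2)
  show ?thesis
    using polar_form_of_orthogonal_columns[OF s1 s2 c1 c2 orth] V that B_def by metis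
qed

section \<open>The quartic of a polar form\<close>

text \<open>Written with \<open>z = x + i y\<close>, the dependence of \<open>P\<close> on a common phase of \<open>A\<close> and \<open>z\<close>
  becomes visible: each term is unchanged when \<open>(trace A, det A, z)\<close> is replaced by
  \<open>(\<omega> trace A, \<omega>\<^sup>2 det A, \<omega> z)\<close> with \<open>|\<omega>| = 1\<close>.\<close>
lemma P_eq_complex:
  "P A (Re z) (Im z) t =
     (cmod (det A))\<^sup>2
     - 2 * Re (det A * trace (adj A) * cnj z) * t
     + (Re (trace (adj A ** A)) * (cmod z)\<^sup>2 + 2 * Re (det A * (cnj z)\<^sup>2)
        + (cmod (trace A))\<^sup>2 - Re (trace (adj A ** A))) * t\<^sup>2
     - 2 * Re (trace A * cnj z) * t ^ 3 + t ^ 4"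
  unfolding P_def Let_def cmod_power2[of z]
  by (simp add: algebra_simps power2_eq_square)

lemma mem_E_iff: "z \<in> E A t \<longleftrightarrow> P A (Re z) (Im z) t = 0"
proof
  assume "P A (Re z) (Im z) t = 0"
  then show "z \<in> E A t"
    unfolding E_def by (intro CollectI exI[of _ "Re z"] exI[of _ "Im z"]) simp
qed (auto simp: E_def)

context
  fixes \<omega> u v :: complex and s\<^sub>1 s\<^sub>2 :: real
  assumes \<omega>: "cmod \<omega> = 1" and uv: "(cmod u)\<^sup>2 + (cmod v)\<^sup>2 = 1"
begin

lemma unimodular_cnj: "\<omega> * cnj \<omega> = 1" "cnj \<omega> * \<omega> = 1"
  using \<omega> complex_norm_square[of \<omega>] by (simp_all add: mult.commute)

lemma unit_vector_cnj: "u * cnj u + v * cnj v = 1"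
  using uv by (metis complex_norm_square of_real_1 of_real_add)

lemma trace_polar_form: "trace (polar_form \<omega> u v s\<^sub>1 s\<^sub>2) = \<omega> * (of_real s\<^sub>1 * u + of_real s\<^sub>2 * cnj u)"
  by (simp add: trace_def sum_2 algebra_simps)

lemma det_polar_form: "det (polar_form \<omega> u v s\<^sub>1 s\<^sub>2) = \<omega>\<^sup>2 * of_real (s\<^sub>1 * s\<^sub>2)"
proof -
  have "det (polar_form \<omega> u v s\<^sub>1 s\<^sub>2) = \<omega>\<^sup>2 * of_real (s\<^sub>1 * s\<^sub>2) * (u * cnj u + v * cnj v)"
    by (simp add: det_2 algebra_simps power2_eq_square)
  then show ?thesis by (simp add: unit_vector_cnj)
qed

lemma trace_gram_polar_form:
  "trace (adj (polar_form \<omega> u v s\<^sub>1 s\<^sub>2) ** polar_form \<omega> u v s\<^sub>1 s\<^sub>2) = of_real (s\<^sub>1\<^sup>2 + s\<^sub>2\<^sup>2)"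
proof -
  have "trace (adj (polar_form \<omega> u v s\<^sub>1 s\<^sub>2) ** polar_form \<omega> u v s\<^sub>1 s\<^sub>2)
      = (\<omega> * cnj \<omega>) * of_real (s\<^sub>1\<^sup>2 + s\<^sub>2\<^sup>2) * (u * cnj u + v * cnj v)"
    by (simp add: trace_def adj_def matrix_matrix_mult_def sum_2 algebra_simps power2_eq_square)
  then show ?thesis by (simp add: unit_vector_cnj unimodular_cnj)
qed

text \<open>The key identity.  In the rotated coordinate \<open>\<zeta>\<close>, and for fixed \<open>t\<close>, the quartic becomes a sum of
  two squares minus a constant, from which the centre and the semi-axes of the ellipse \<open>P = 0\<close>
  can be read off if \<open>s\<^sub>1 < s\<^sub>2\<close> and \<open>t\<close> is a positive number between them.
  After the phase \<open>\<omega>\<close> has cancelled, only a polynomial identity in real variables remains,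
  in which \<open>|v|\<^sup>2\<close> is \<open>1 - (Re u)\<^sup>2 - (Im u)\<^sup>2\<close>.\<close>
lemma P_polar_form:
  "P (polar_form \<omega> u v s\<^sub>1 s\<^sub>2) (Re (\<omega> * \<zeta>)) (Im (\<omega> * \<zeta>)) t =
     ((s\<^sub>1 + s\<^sub>2) * (t * Re \<zeta>) - (t\<^sup>2 + s\<^sub>1 * s\<^sub>2) * Re u)\<^sup>2
     + ((s\<^sub>2 - s\<^sub>1) * (t * Im \<zeta>) - (s\<^sub>1 * s\<^sub>2 - t\<^sup>2) * Im u)\<^sup>2
     - (cmod v)\<^sup>2 * ((t\<^sup>2 - s\<^sub>1\<^sup>2) * (s\<^sub>2\<^sup>2 - t\<^sup>2))"
proof -
  define \<tau> where "\<tau> = of_real s\<^sub>1 * u + of_real s\<^sub>2 * cnj u"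
  have \<tau>: "Re \<tau> = (s\<^sub>1 + s\<^sub>2) * Re u" "Im \<tau> = (s\<^sub>1 - s\<^sub>2) * Im u"
    by (simp_all add: \<tau>_def algebra_simps)
  have 1: "\<omega>\<^sup>2 * of_real (s\<^sub>1 * s\<^sub>2) * cnj (\<omega> * \<tau>) * cnj (\<omega> * \<zeta>) = of_real (s\<^sub>1 * s\<^sub>2) * (cnj \<tau> * cnj \<zeta>)"
  proof -
    have "\<omega>\<^sup>2 * of_real (s\<^sub>1 * s\<^sub>2) * cnj (\<omega> * \<tau>) * cnj (\<omega> * \<zeta>)
      = (\<omega> * cnj \<omega>)\<^sup>2 * (of_real (s\<^sub>1 * s\<^sub>2) * (cnj \<tau> * cnj \<zeta>))"
      by (simp add: power2_eq_square mult_ac)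
    then show ?thesis by (simp add: unimodular_cnj)
  qed
  have 2: "\<omega>\<^sup>2 * of_real (s\<^sub>1 * s\<^sub>2) * (cnj (\<omega> * \<zeta>))\<^sup>2 = of_real (s\<^sub>1 * s\<^sub>2) * (cnj \<zeta>)\<^sup>2"
  proof -
    have "\<omega>\<^sup>2 * of_real (s\<^sub>1 * s\<^sub>2) * (cnj (\<omega> * \<zeta>))\<^sup>2 = (\<omega> * cnj \<omega>)\<^sup>2 * (of_real (s\<^sub>1 * s\<^sub>2) * (cnj \<zeta>)\<^sup>2)"
      by (simp add: power2_eq_square mult_ac)
    then show ?thesis by (simp add: unimodular_cnj)
  qed
  have 3: "\<omega> * \<tau> * cnj (\<omega> * \<zeta>) = \<tau> * cnj \<zeta>"
  proof -
    have "\<omega> * \<tau> * cnj (\<omega> * \<zeta>) = (\<omega> * cnj \<omega>) * (\<tau> * cnj \<zeta>)" by (simp add: mult_ac)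
    then show ?thesis by (simp add: unimodular_cnj)
  qed
  have v: "(cmod v)\<^sup>2 = 1 - (Re u)\<^sup>2 - (Im u)\<^sup>2"
    using uv unfolding cmod_power2 by simp
  have n: "(cmod (\<omega>\<^sup>2 * of_real (s\<^sub>1 * s\<^sub>2)))\<^sup>2 = (s\<^sub>1 * s\<^sub>2)\<^sup>2" "cmod (\<omega> * \<zeta>) = cmod \<zeta>" "cmod (\<omega> * \<tau>) = cmod \<tau>"
    by (simp_all add: norm_mult norm_power \<omega> power_mult_distrib)
  have poly: "(s\<^sub>1 * s\<^sub>2)\<^sup>2 - 2 * (s\<^sub>1 * s\<^sub>2 * ((s\<^sub>1 + s\<^sub>2) * a * x - (s\<^sub>1 - s\<^sub>2) * b * y)) * t
      + ((s\<^sub>1\<^sup>2 + s\<^sub>2\<^sup>2) * (x\<^sup>2 + y\<^sup>2) + 2 * (s\<^sub>1 * s\<^sub>2 * (x\<^sup>2 - y\<^sup>2))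
         + (((s\<^sub>1 + s\<^sub>2) * a)\<^sup>2 + ((s\<^sub>1 - s\<^sub>2) * b)\<^sup>2) - (s\<^sub>1\<^sup>2 + s\<^sub>2\<^sup>2)) * t\<^sup>2
      - 2 * ((s\<^sub>1 + s\<^sub>2) * a * x + (s\<^sub>1 - s\<^sub>2) * b * y) * t ^ 3 + t ^ 4
    = ((s\<^sub>1 + s\<^sub>2) * (t * x) - (t\<^sup>2 + s\<^sub>1 * s\<^sub>2) * a)\<^sup>2 + ((s\<^sub>2 - s\<^sub>1) * (t * y) - (s\<^sub>1 * s\<^sub>2 - t\<^sup>2) * b)\<^sup>2
      - (1 - a\<^sup>2 - b\<^sup>2) * ((t\<^sup>2 - s\<^sub>1\<^sup>2) * (s\<^sub>2\<^sup>2 - t\<^sup>2))" for a b x y :: real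
    by (simp add: algebra_simps power2_eq_square power3_eq_cube power4_eq_xxxx)
  have re: "Re (of_real (s\<^sub>1 * s\<^sub>2) * (cnj \<tau> * cnj \<zeta>)) = s\<^sub>1 * s\<^sub>2 * ((s\<^sub>1 + s\<^sub>2) * Re u * Re \<zeta> - (s\<^sub>1 - s\<^sub>2) * Im u * Im \<zeta>)"
    "Re (of_real (s\<^sub>1 * s\<^sub>2) * (cnj \<zeta>)\<^sup>2) = s\<^sub>1 * s\<^sub>2 * ((Re \<zeta>)\<^sup>2 - (Im \<zeta>)\<^sup>2)"
    "Re (\<tau> * cnj \<zeta>) = (s\<^sub>1 + s\<^sub>2) * Re u * Re \<zeta> + (s\<^sub>1 - s\<^sub>2) * Im u * Im \<zeta>"
    "Re (of_real (s\<^sub>1\<^sup>2 + s\<^sub>2\<^sup>2)) = s\<^sub>1\<^sup>2 + s\<^sub>2\<^sup>2"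
    "(cmod \<zeta>)\<^sup>2 = (Re \<zeta>)\<^sup>2 + (Im \<zeta>)\<^sup>2"
    "(cmod \<tau>)\<^sup>2 = ((s\<^sub>1 + s\<^sub>2) * Re u)\<^sup>2 + ((s\<^sub>1 - s\<^sub>2) * Im u)\<^sup>2"
    by (simp_all add: \<tau> cmod_power2 power2_eq_square[of "cnj \<zeta>"] power2_eq_square[of "Re \<zeta>"]
        power2_eq_square[of "Im \<zeta>"] del: of_real_mult of_real_add)
  show ?thesis
    unfolding P_eq_complex trace_adj trace_gram_polar_form det_polar_form trace_polar_form
      \<tau>_def[symmetric] 1 2 3 n v re by (rule poly)
qed

section \<open>The normalized numerical range of a polar form\<close>

lemma norm_polar_form_mult:
  "(norm (polar_form \<omega> u v s\<^sub>1 s\<^sub>2 *v x))\<^sup>2 = s\<^sub>1\<^sup>2 * (cmod (x $ 1))\<^sup>2 + s\<^sub>2\<^sup>2 * (cmod (x $ 2))\<^sup>2"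
proof -
  let ?a = "of_real s\<^sub>1 * u * x $ 1 - of_real s\<^sub>2 * cnj v * x $ 2"
  let ?b = "of_real s\<^sub>1 * v * x $ 1 + of_real s\<^sub>2 * cnj u * x $ 2"
  have "polar_form \<omega> u v s\<^sub>1 s\<^sub>2 *v x = vector [\<omega> * ?a, \<omega> * ?b]"
    by (simp add: vec_eq_iff forall_2 matrix_vector_mult_def sum_2 algebra_simps)
  then have "complex_of_real ((norm (polar_form \<omega> u v s\<^sub>1 s\<^sub>2 *v x))\<^sup>2)
      = (\<omega> * cnj \<omega>) * (?a * cnj ?a + ?b * cnj ?b)"
    unfolding cdot_self[symmetric] by (simp add: cdot_def sum_2 algebra_simps)
  also have "\<dots> = (u * cnj u + v * cnj v) * (of_real s\<^sub>1 ^ 2 * (x $ 1 * cnj (x $ 1)) + of_real s\<^sub>2 ^ 2 * (x $ 2 * cnj (x $ 2)))"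
    by (simp add: unimodular_cnj algebra_simps power2_eq_square)
  also have "\<dots> = of_real (s\<^sub>1\<^sup>2 * (cmod (x $ 1))\<^sup>2 + s\<^sub>2\<^sup>2 * (cmod (x $ 2))\<^sup>2)"
    by (simp only: unit_vector_cnj complex_norm_square of_real_add of_real_mult of_real_power[of s\<^sub>1] of_real_power[of s\<^sub>2] mult_1)
  finally show ?thesis by (simp only: of_real_eq_iff)
qed

lemma cdot_polar_form:
  "cdot x (polar_form \<omega> u v s\<^sub>1 s\<^sub>2 *v x) = \<omega> * Complex
     ((s\<^sub>1 * (cmod (x $ 1))\<^sup>2 + s\<^sub>2 * (cmod (x $ 2))\<^sup>2) * Re u - (s\<^sub>2 - s\<^sub>1) * Re (v * x $ 1 * cnj (x $ 2)))
     ((s\<^sub>1 * (cmod (x $ 1))\<^sup>2 - s\<^sub>2 * (cmod (x $ 2))\<^sup>2) * Im u + (s\<^sub>1 + s\<^sub>2) * Im (v * x $ 1 * cnj (x $ 2)))"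
    (is "?l = \<omega> * ?r")
proof -
  have "?l = \<omega> * (of_real s\<^sub>1 * (x $ 1 * cnj (x $ 1)) * u + of_real s\<^sub>2 * (x $ 2 * cnj (x $ 2)) * cnj u
      + of_real s\<^sub>1 * (v * x $ 1 * cnj (x $ 2)) - of_real s\<^sub>2 * cnj (v * x $ 1 * cnj (x $ 2)))"
    by (simp add: cdot_def matrix_vector_mult_def sum_2 algebra_simps)
  also have "\<dots> = \<omega> * ?r"
    unfolding complex_norm_square[symmetric] by (intro arg_cong[of _ _ "(*) \<omega>"] complex_eqI) (simp_all add: algebra_simps)
  finally show ?thesis .
qed

text \<open>A unit vector enters only through the moduli of its coordinates, which determine
  \<open>t = norm (A x)\<close>, and the number \<open>g = v x\<^sub>1 cnj x\<^sub>2\<close>.  For fixed moduli, \<open>g\<close> runs through a circle, and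
  \<open>t \<zeta>\<close> depends on \<open>g\<close> by stretching the two coordinates by different factors: this is the source
  of the ellipses.\<close>
lemma mem_normalized_numerical_range_polar_form:
  "\<omega> * \<zeta> \<in> normalized_numerical_range (polar_form \<omega> u v s\<^sub>1 s\<^sub>2) \<longleftrightarrow>
    (\<exists>x\<^sub>1 x\<^sub>2 t. (cmod x\<^sub>1)\<^sup>2 + (cmod x\<^sub>2)\<^sup>2 = 1 \<and> 0 < t \<and>
       t\<^sup>2 = s\<^sub>1\<^sup>2 * (cmod x\<^sub>1)\<^sup>2 + s\<^sub>2\<^sup>2 * (cmod x\<^sub>2)\<^sup>2 \<and>
       t * Re \<zeta> = (s\<^sub>1 * (cmod x\<^sub>1)\<^sup>2 + s\<^sub>2 * (cmod x\<^sub>2)\<^sup>2) * Re u - (s\<^sub>2 - s\<^sub>1) * Re (v * x\<^sub>1 * cnj x\<^sub>2) \<and>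
       t * Im \<zeta> = (s\<^sub>1 * (cmod x\<^sub>1)\<^sup>2 - s\<^sub>2 * (cmod x\<^sub>2)\<^sup>2) * Im u + (s\<^sub>1 + s\<^sub>2) * Im (v * x\<^sub>1 * cnj x\<^sub>2))"
    (is "_ \<longleftrightarrow> ?R")
proof
  let ?B = "polar_form \<omega> u v s\<^sub>1 s\<^sub>2"
  have \<omega>0: "\<omega> \<noteq> 0" using \<omega> by auto
  have nx: "(norm x)\<^sup>2 = (cmod (x $ 1))\<^sup>2 + (cmod (x $ 2))\<^sup>2" for x :: "complex^2"
    by (simp add: norm_vec_def L2_set_def sum_2)
  {
    assume "\<omega> * \<zeta> \<in> normalized_numerical_range ?B"
    then obtain x where x: "norm x = 1" "?B *v x \<noteq> 0"
      and z: "\<omega> * \<zeta> = cdot x (?B *v x) / complex_of_real (norm (?B *v x))"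
      by (auto simp: normalized_numerical_range_unit)
    define t where "t = norm (?B *v x)"
    have t: "0 < t" using x(2) by (simp add: t_def)
    have "of_real t * (\<omega> * \<zeta>) = cdot x (?B *v x)"
      using t by (simp add: z t_def)
    then have "\<omega> * (of_real t * \<zeta>) = cdot x (?B *v x)" by (simp only: mult.left_commute)
    then have "of_real t * \<zeta> = Complex
     ((s\<^sub>1 * (cmod (x $ 1))\<^sup>2 + s\<^sub>2 * (cmod (x $ 2))\<^sup>2) * Re u - (s\<^sub>2 - s\<^sub>1) * Re (v * x $ 1 * cnj (x $ 2)))
     ((s\<^sub>1 * (cmod (x $ 1))\<^sup>2 - s\<^sub>2 * (cmod (x $ 2))\<^sup>2) * Im u + (s\<^sub>1 + s\<^sub>2) * Im (v * x $ 1 * cnj (x $ 2)))"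
      unfolding cdot_polar_form by (rule mult_left_cancel[OF \<omega>0, THEN iffD1])
    then show ?R
      using x(1) nx[of x] norm_polar_form_mult[of x] t unfolding t_def[symmetric]
      by (intro exI[of _ "x $ 1"] exI[of _ "x $ 2"] exI[of _ t]) (simp add: complex_eq_iff)
  }
  assume ?R
  then obtain x\<^sub>1 x\<^sub>2 t where x: "(cmod x\<^sub>1)\<^sup>2 + (cmod x\<^sub>2)\<^sup>2 = 1" and t: "0 < t"
    "t\<^sup>2 = s\<^sub>1\<^sup>2 * (cmod x\<^sub>1)\<^sup>2 + s\<^sub>2\<^sup>2 * (cmod x\<^sub>2)\<^sup>2"
    and \<zeta>: "t * Re \<zeta> = (s\<^sub>1 * (cmod x\<^sub>1)\<^sup>2 + s\<^sub>2 * (cmod x\<^sub>2)\<^sup>2) * Re u - (s\<^sub>2 - s\<^sub>1) * Re (v * x\<^sub>1 * cnj x\<^sub>2)"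
       "t * Im \<zeta> = (s\<^sub>1 * (cmod x\<^sub>1)\<^sup>2 - s\<^sub>2 * (cmod x\<^sub>2)\<^sup>2) * Im u + (s\<^sub>1 + s\<^sub>2) * Im (v * x\<^sub>1 * cnj x\<^sub>2)"
    by blast
  define x :: "complex^2" where "x = vector [x\<^sub>1, x\<^sub>2]"
  have x12: "x $ 1 = x\<^sub>1" "x $ 2 = x\<^sub>2" by (simp_all add: x_def)
  have "norm x = 1" using nx[of x] x by (simp add: x12 power2_eq_1_iff) (smt (verit) norm_ge_zero)
  moreover have nt: "norm (?B *v x) = t"
    using norm_polar_form_mult[of x, unfolded x12 t(2)[symmetric]] t(1) by (simp add: power2_eq_iff_nonneg)
  moreover have "?B *v x \<noteq> 0" using nt t(1) by auto
  moreover have "cdot x (?B *v x) = \<omega> * (of_real t * \<zeta>)"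
    unfolding cdot_polar_form x12 \<zeta>[symmetric] by (simp add: complex_eq_iff)
  ultimately show "\<omega> * \<zeta> \<in> normalized_numerical_range ?B"
    unfolding normalized_numerical_range_unit using t(1)
    by (intro CollectI exI[of _ x]) simp
qed

end

section \<open>Rotated ellipses and segments\<close>

text \<open>The radius \<open>r = 0\<close>, a single point, has to be allowed: it occurs when \<open>t\<close> is a
  singular value, or when \<open>v = 0\<close>.\<close>
lemma ellipse_rotated_axis_parallel:
  fixes \<omega> :: complex and \<alpha> \<beta> :: real
  assumes "0 < \<alpha>" "0 < \<beta>" "0 \<le> r"
  shows "ellipse {\<omega> * \<zeta> | \<zeta>. (\<alpha> * Re \<zeta> - m\<^sub>1)\<^sup>2 + (\<beta> * Im \<zeta> - m\<^sub>2)\<^sup>2 = r\<^sup>2}"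
    (is "ellipse ?S")
proof -
  let ?c = "\<omega> * Complex (m\<^sub>1 / \<alpha>) (m\<^sub>2 / \<beta>)" and ?p = "\<omega> * Complex (r / \<alpha>) 0"
    and ?q = "\<omega> * Complex 0 (r / \<beta>)"
  have pt: "?c + cos \<theta> *\<^sub>R ?p + sin \<theta> *\<^sub>R ?q
      = \<omega> * Complex ((m\<^sub>1 + r * cos \<theta>) / \<alpha>) ((m\<^sub>2 + r * sin \<theta>) / \<beta>)" for \<theta>
    by (simp add: complex_eq_iff algebra_simps add_divide_distrib)
  have "?S = {?c + cos \<theta> *\<^sub>R ?p + sin \<theta> *\<^sub>R ?q | \<theta>::real. True}"
    unfolding pt
  proof (intro subset_antisym subsetI)
    fix z assume "z \<in> ?S"
    then obtain \<zeta> where z: "z = \<omega> * \<zeta>"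
      and eq: "(\<alpha> * Re \<zeta> - m\<^sub>1)\<^sup>2 + (\<beta> * Im \<zeta> - m\<^sub>2)\<^sup>2 = r\<^sup>2" by blast
    obtain \<theta> where \<theta>: "\<alpha> * Re \<zeta> - m\<^sub>1 = r * cos \<theta>" "\<beta> * Im \<zeta> - m\<^sub>2 = r * sin \<theta>"
    proof -
      define w where "w = Complex (\<alpha> * Re \<zeta> - m\<^sub>1) (\<beta> * Im \<zeta> - m\<^sub>2)"
      have "cmod w = r" using eq assms(3) by (simp add: w_def cmod_def)
      then have "w = rcis r (Arg w)" using rcis_cmod_Arg[of w] by simp
      then show ?thesis using that[of "Arg w"]
        by (metis Im_rcis Re_rcis complex.sel w_def)
    qed
    have "\<zeta> = Complex ((m\<^sub>1 + r * cos \<theta>) / \<alpha>) ((m\<^sub>2 + r * sin \<theta>) / \<beta>)"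
      using assms \<theta> by (simp add: complex_eq_iff field_simps)
    then show "z \<in> {\<omega> * Complex ((m\<^sub>1 + r * cos \<theta>) / \<alpha>) ((m\<^sub>2 + r * sin \<theta>) / \<beta>) | \<theta>. True}"
      using z by blast
  next
    fix z assume "z \<in> {\<omega> * Complex ((m\<^sub>1 + r * cos \<theta>) / \<alpha>) ((m\<^sub>2 + r * sin \<theta>) / \<beta>) | \<theta>. True}"
    then obtain \<theta> where z: "z = \<omega> * Complex ((m\<^sub>1 + r * cos \<theta>) / \<alpha>) ((m\<^sub>2 + r * sin \<theta>) / \<beta>)"
      by blast
    have "(r * cos \<theta>)\<^sup>2 + (r * sin \<theta>)\<^sup>2 = r\<^sup>2"
      by (simp add: power_mult_distrib flip: distrib_left)
    then show "z \<in> ?S" using z assms by auto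
  qed
  then show ?thesis unfolding ellipse_def by blast
qed

lemma ellipse_rotated_vertical_segment:
  fixes \<omega> :: complex
  assumes "0 \<le> r"
  shows "ellipse {\<omega> * \<zeta> | \<zeta>. Re \<zeta> = m \<and> \<bar>Im \<zeta>\<bar> \<le> r}" (is "ellipse ?S")
proof -
  have pt: "\<omega> * Complex m 0 + cos \<theta> *\<^sub>R (\<omega> * Complex 0 r) + sin \<theta> *\<^sub>R 0
      = \<omega> * Complex m (r * cos \<theta>)" for \<theta>
    by (simp add: complex_eq_iff algebra_simps)
  have "?S = {\<omega> * Complex m 0 + cos \<theta> *\<^sub>R (\<omega> * Complex 0 r) + sin \<theta> *\<^sub>R 0 | \<theta>::real. True}"
    unfolding pt
  proof (intro subset_antisym subsetI)
    fix z assume "z \<in> ?S"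
    then obtain \<zeta> where z: "z = \<omega> * \<zeta>" "Re \<zeta> = m" "\<bar>Im \<zeta>\<bar> \<le> r" by blast
    have "\<bar>Im \<zeta> / r\<bar> \<le> 1" using z(3) assms by (auto simp: divide_le_eq_1)
    then have "cos (arccos (Im \<zeta> / r)) = Im \<zeta> / r" by (intro cos_arccos_abs)
    moreover have "r * (Im \<zeta> / r) = Im \<zeta>" using z(3) by auto
    ultimately have "Complex m (r * cos (arccos (Im \<zeta> / r))) = \<zeta>"
      using z by (simp add: complex_eq_iff)
    then show "z \<in> {\<omega> * Complex m (r * cos \<theta>) | \<theta>. True}"
      unfolding z(1) by (intro CollectI exI[of _ "arccos (Im \<zeta> / r)"]) simp
  next
    fix z assume "z \<in> {\<omega> * Complex m (r * cos \<theta>) | \<theta>. True}"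
    then obtain \<theta> where "z = \<omega> * Complex m (r * cos \<theta>)" by blast
    moreover have "\<bar>r * cos \<theta>\<bar> \<le> r"
      using assms by (simp add: abs_mult mult_left_le)
    ultimately show "z \<in> ?S" by auto
  qed
  then show ?thesis unfolding ellipse_def by blast
qed

section \<open>Comparison with the zero sets of the quartic\<close>

text \<open>Only the phase of \<open>x\<^sub>2\<close> has to be adjusted; if \<open>v\<close> or \<open>a\<close> vanishes then so does
  \<open>G\<close>, and any phase will do.\<close>
lemma exists_factors_of_prescribed_modulus:
  fixes v G :: complex and a b :: real
  assumes "0 \<le> a" "0 \<le> b" "(cmod G)\<^sup>2 = (cmod v)\<^sup>2 * (a * b)"
  obtains x\<^sub>1 x\<^sub>2 where "(cmod x\<^sub>1)\<^sup>2 = a" "(cmod x\<^sub>2)\<^sup>2 = b" "v * x\<^sub>1 * cnj x\<^sub>2 = G"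
proof (cases "v = 0 \<or> a = 0")
  case True
  then have "G = 0" using assms(3) by auto
  then show ?thesis
    using that[of "of_real (sqrt a)" "of_real (sqrt b)"] True assms(1,2) by auto
next
  case False
  define x\<^sub>2 where "x\<^sub>2 = cnj (G / (v * of_real (sqrt a)))"
  have "(cmod x\<^sub>2)\<^sup>2 = b"
    using False assms by (simp add: x\<^sub>2_def norm_divide norm_mult power_divide power_mult_distrib)
  moreover have "v * of_real (sqrt a) * cnj x\<^sub>2 = G" using False assms(1) by (simp add: x\<^sub>2_def)
  ultimately show ?thesis using that[of "of_real (sqrt a)" x\<^sub>2] assms(1) by simp
qed

lemma rotated_cases:
  assumes "cmod \<omega> = 1"
  obtains \<zeta> where "z = \<omega> * \<zeta>"
proof -
  have "\<omega> \<noteq> 0" using assms by auto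
  then show ?thesis using that[of "z / \<omega>"] by simp
qed

lemma set_eq_rotated:
  assumes "cmod \<omega> = 1"
  shows "S = {\<omega> * \<zeta> | \<zeta>. \<omega> * \<zeta> \<in> S}"
proof (intro subset_antisym subsetI)
  fix z assume "z \<in> S"
  moreover obtain \<zeta> where "z = \<omega> * \<zeta>" using rotated_cases[OF assms] .
  ultimately show "z \<in> {\<omega> * \<zeta> | \<zeta>. \<omega> * \<zeta> \<in> S}" by blast
qed blast

context
  fixes \<omega> u v :: complex and s\<^sub>1 s\<^sub>2 :: real
  assumes \<omega>: "cmod \<omega> = 1" and uv: "(cmod u)\<^sup>2 + (cmod v)\<^sup>2 = 1"
    and s: "0 \<le> s\<^sub>1" "s\<^sub>1 \<le> s\<^sub>2"
begin

lemma mem_E_polar_form: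
  "\<omega> * \<zeta> \<in> E (polar_form \<omega> u v s\<^sub>1 s\<^sub>2) t \<longleftrightarrow>
     ((s\<^sub>1 + s\<^sub>2) * (t * Re \<zeta>) - (t\<^sup>2 + s\<^sub>1 * s\<^sub>2) * Re u)\<^sup>2
     + ((s\<^sub>2 - s\<^sub>1) * (t * Im \<zeta>) - (s\<^sub>1 * s\<^sub>2 - t\<^sup>2) * Im u)\<^sup>2
     = (cmod v)\<^sup>2 * ((t\<^sup>2 - s\<^sub>1\<^sup>2) * (s\<^sub>2\<^sup>2 - t\<^sup>2))"
  unfolding mem_E_iff P_polar_form[OF \<omega> uv] by auto

text \<open>For \<open>|x\<^sub>1|\<^sup>2 = a\<close> and \<open>|x\<^sub>2|\<^sup>2 = 1 - a\<close>, the value \<open>t\<^sup>2\<close> is a convex combination of \<open>s\<^sub>1\<^sup>2\<close>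
  and \<open>s\<^sub>2\<^sup>2\<close>, and the two squares in the equation of \<open>E\<close> are those of \<open>Re g\<close> and \<open>Im g\<close>, both
  scaled by \<open>s\<^sub>2\<^sup>2 - s\<^sub>1\<^sup>2\<close>.  The equation follows from
  \<open>|g|\<^sup>2 = |v|\<^sup>2 a (1 - a)\<close>, which holds by the definition of \<open>g\<close>.\<close>
lemma normalized_numerical_range_polar_form_subset:
  assumes "z \<in> normalized_numerical_range (polar_form \<omega> u v s\<^sub>1 s\<^sub>2)"
  shows "\<exists>t. s\<^sub>1 \<le> t \<and> t \<le> s\<^sub>2 \<and> t \<noteq> 0 \<and> z \<in> E (polar_form \<omega> u v s\<^sub>1 s\<^sub>2) t"
proof -
  obtain \<zeta> where z: "z = \<omega> * \<zeta>" by (rule rotated_cases[OF \<omega>])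
  obtain x\<^sub>1 x\<^sub>2 t where x: "(cmod x\<^sub>1)\<^sup>2 + (cmod x\<^sub>2)\<^sup>2 = 1" and t: "0 < t"
    and tt: "t\<^sup>2 = s\<^sub>1\<^sup>2 * (cmod x\<^sub>1)\<^sup>2 + s\<^sub>2\<^sup>2 * (cmod x\<^sub>2)\<^sup>2"
    and \<zeta>: "t * Re \<zeta> = (s\<^sub>1 * (cmod x\<^sub>1)\<^sup>2 + s\<^sub>2 * (cmod x\<^sub>2)\<^sup>2) * Re u - (s\<^sub>2 - s\<^sub>1) * Re (v * x\<^sub>1 * cnj x\<^sub>2)"
       "t * Im \<zeta> = (s\<^sub>1 * (cmod x\<^sub>1)\<^sup>2 - s\<^sub>2 * (cmod x\<^sub>2)\<^sup>2) * Im u + (s\<^sub>1 + s\<^sub>2) * Im (v * x\<^sub>1 * cnj x\<^sub>2)"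
    using assms unfolding z mem_normalized_numerical_range_polar_form[OF \<omega> uv] by blast
  define a where "a = (cmod x\<^sub>1)\<^sup>2"
  define b where "b = (cmod x\<^sub>2)\<^sup>2"
  define g where "g = v * x\<^sub>1 * cnj x\<^sub>2"
  note tt = tt[folded a_def b_def] and \<zeta> = \<zeta>[folded a_def b_def g_def]
  have b1: "b = 1 - a" and ab: "0 \<le> a" "0 \<le> b"
    using x by (simp_all add: a_def b_def)
  have g: "(Re g)\<^sup>2 + (Im g)\<^sup>2 = (cmod v)\<^sup>2 * (a * b)"
    unfolding cmod_power2[symmetric] by (simp add: g_def norm_mult power_mult_distrib a_def b_def)
  have t1: "t\<^sup>2 - s\<^sub>1\<^sup>2 = (s\<^sub>2\<^sup>2 - s\<^sub>1\<^sup>2) * b" and t2: "s\<^sub>2\<^sup>2 - t\<^sup>2 = (s\<^sub>2\<^sup>2 - s\<^sub>1\<^sup>2) * a"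
    using tt by (simp_all add: b1 algebra_simps)
  have s12: "0 \<le> s\<^sub>2\<^sup>2 - s\<^sub>1\<^sup>2" using s by (simp add: power_mono)
  have "s\<^sub>1\<^sup>2 \<le> t\<^sup>2" "t\<^sup>2 \<le> s\<^sub>2\<^sup>2"
    using t1 t2 mult_nonneg_nonneg[OF s12 ab(1)] mult_nonneg_nonneg[OF s12 ab(2)] by linarith+
  then have "s\<^sub>1 \<le> t" "t \<le> s\<^sub>2" using s t by (auto intro: power2_le_imp_le)
  moreover have "z \<in> E (polar_form \<omega> u v s\<^sub>1 s\<^sub>2) t"
  proof -
    have X: "(s\<^sub>1 + s\<^sub>2) * (t * Re \<zeta>) - (t\<^sup>2 + s\<^sub>1 * s\<^sub>2) * Re u = - ((s\<^sub>2\<^sup>2 - s\<^sub>1\<^sup>2) * Re g)"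
      unfolding \<zeta>(1) tt b1 by (simp add: algebra_simps power2_eq_square)
    have Y: "(s\<^sub>2 - s\<^sub>1) * (t * Im \<zeta>) - (s\<^sub>1 * s\<^sub>2 - t\<^sup>2) * Im u = (s\<^sub>2\<^sup>2 - s\<^sub>1\<^sup>2) * Im g"
      unfolding \<zeta>(2) tt b1 by (simp add: algebra_simps power2_eq_square)
    have "(- ((s\<^sub>2\<^sup>2 - s\<^sub>1\<^sup>2) * Re g))\<^sup>2 + ((s\<^sub>2\<^sup>2 - s\<^sub>1\<^sup>2) * Im g)\<^sup>2
        = (s\<^sub>2\<^sup>2 - s\<^sub>1\<^sup>2)\<^sup>2 * ((Re g)\<^sup>2 + (Im g)\<^sup>2)"
      by (simp add: power_mult_distrib distrib_left)
    then show ?thesis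
      unfolding z mem_E_polar_form X Y t1 t2 g by (simp add: power2_eq_square)
  qed
  ultimately show ?thesis using t by auto
qed

text \<open>When \<open>s\<^sub>1 < s\<^sub>2\<close> the previous computation can be reversed: \<open>t\<close> determines the moduli of
  \<open>x\<^sub>1\<close> and \<open>x\<^sub>2\<close>, the point of \<open>E\<close> determines \<open>g\<close>, and the equation of \<open>E\<close> is exactly the
  condition on \<open>|g|\<close> under which a vector realizing \<open>g\<close> exists.\<close>
lemma E_subset_normalized_numerical_range_polar_form:
  assumes "s\<^sub>1 < s\<^sub>2" "s\<^sub>1 \<le> t" "t \<le> s\<^sub>2" "t \<noteq> 0"
  shows "E (polar_form \<omega> u v s\<^sub>1 s\<^sub>2) t \<subseteq> normalized_numerical_range (polar_form \<omega> u v s\<^sub>1 s\<^sub>2)"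
proof
  fix z assume zE: "z \<in> E (polar_form \<omega> u v s\<^sub>1 s\<^sub>2) t"
  obtain \<zeta> where z: "z = \<omega> * \<zeta>" by (rule rotated_cases[OF \<omega>])
  define k where "k = s\<^sub>2\<^sup>2 - s\<^sub>1\<^sup>2"
  have k: "0 < k" using assms s by (simp add: k_def power_strict_mono)
  have k': "k = (s\<^sub>2 - s\<^sub>1) * (s\<^sub>1 + s\<^sub>2)" by (simp add: k_def power2_eq_square algebra_simps)
  define X where "X = (s\<^sub>1 + s\<^sub>2) * (t * Re \<zeta>) - (t\<^sup>2 + s\<^sub>1 * s\<^sub>2) * Re u"
  define Y where "Y = (s\<^sub>2 - s\<^sub>1) * (t * Im \<zeta>) - (s\<^sub>1 * s\<^sub>2 - t\<^sup>2) * Im u"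
  \<comment> \<open>The solution of \<open>a + b = 1\<close> and \<open>s\<^sub>1\<^sup>2 a + s\<^sub>2\<^sup>2 b = t\<^sup>2\<close>.\<close>
  define a where "a = (s\<^sub>2\<^sup>2 - t\<^sup>2) / k"
  define b where "b = (t\<^sup>2 - s\<^sub>1\<^sup>2) / k"
  have XY: "X\<^sup>2 + Y\<^sup>2 = (cmod v)\<^sup>2 * ((t\<^sup>2 - s\<^sub>1\<^sup>2) * (s\<^sub>2\<^sup>2 - t\<^sup>2))"
    using zE unfolding z mem_E_polar_form X_def Y_def .
  have a0: "0 \<le> a" and b0: "0 \<le> b"
    using assms s k by (simp_all add: a_def b_def power_mono)
  have ak: "k * a = s\<^sub>2\<^sup>2 - t\<^sup>2" and bk: "k * b = t\<^sup>2 - s\<^sub>1\<^sup>2" using k by (simp_all add: a_def b_def)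
  have ab1: "a + b = 1" using k by (simp add: a_def b_def k_def flip: add_divide_distrib)
  have "(cmod (Complex (- X / k) (Y / k)))\<^sup>2 = (X\<^sup>2 + Y\<^sup>2) / k\<^sup>2"
    by (simp add: cmod_power2 power_divide add_divide_distrib)
  also have "\<dots> = (cmod v)\<^sup>2 * (a * b)"
    unfolding XY a_def b_def by (simp add: power2_eq_square)
  finally obtain x\<^sub>1 x\<^sub>2 where x: "(cmod x\<^sub>1)\<^sup>2 = a" "(cmod x\<^sub>2)\<^sup>2 = b"
      "v * x\<^sub>1 * cnj x\<^sub>2 = Complex (- X / k) (Y / k)"
    by (rule exists_factors_of_prescribed_modulus[OF a0 b0])
  have tt: "t\<^sup>2 = s\<^sub>1\<^sup>2 * a + s\<^sub>2\<^sup>2 * b"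
  proof -
    have "k * (s\<^sub>1\<^sup>2 * a + s\<^sub>2\<^sup>2 * b) = s\<^sub>1\<^sup>2 * (s\<^sub>2\<^sup>2 - t\<^sup>2) + s\<^sub>2\<^sup>2 * (t\<^sup>2 - s\<^sub>1\<^sup>2)"
      unfolding ak[symmetric] bk[symmetric] by (simp add: algebra_simps)
    also have "\<dots> = k * t\<^sup>2" by (simp add: k_def algebra_simps)
    finally show ?thesis using k by simp
  qed
  have b1: "b = 1 - a" using ab1 by simp
  have m1: "(s\<^sub>1 + s\<^sub>2) * (s\<^sub>1 * a + s\<^sub>2 * b) = t\<^sup>2 + s\<^sub>1 * s\<^sub>2"
    unfolding tt b1 by (simp add: algebra_simps power2_eq_square)
  have m2: "(s\<^sub>2 - s\<^sub>1) * (s\<^sub>1 * a - s\<^sub>2 * b) = s\<^sub>1 * s\<^sub>2 - t\<^sup>2"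
    unfolding tt b1 by (simp add: algebra_simps power2_eq_square)
  have p: "0 < s\<^sub>1 + s\<^sub>2" "0 < s\<^sub>2 - s\<^sub>1" using assms s by auto
  have "(s\<^sub>1 + s\<^sub>2) * (t * Re \<zeta>) = (s\<^sub>1 + s\<^sub>2) * ((s\<^sub>1 * a + s\<^sub>2 * b) * Re u - (s\<^sub>2 - s\<^sub>1) * (- X / k))"
  proof -
    have "(s\<^sub>1 + s\<^sub>2) * ((s\<^sub>1 * a + s\<^sub>2 * b) * Re u - (s\<^sub>2 - s\<^sub>1) * (- X / k))
      = (s\<^sub>1 + s\<^sub>2) * (s\<^sub>1 * a + s\<^sub>2 * b) * Re u + k * (X / k)"
      unfolding k' by (simp add: algebra_simps)
    also have "\<dots> = (s\<^sub>1 + s\<^sub>2) * (t * Re \<zeta>)" using k unfolding m1 by (simp add: X_def)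
    finally show ?thesis by (rule sym)
  qed
  then have re: "t * Re \<zeta> = (s\<^sub>1 * a + s\<^sub>2 * b) * Re u - (s\<^sub>2 - s\<^sub>1) * (- X / k)"
    by (rule mult_left_cancel[THEN iffD1, rotated]) (use p in simp)
  have "(s\<^sub>2 - s\<^sub>1) * (t * Im \<zeta>) = (s\<^sub>2 - s\<^sub>1) * ((s\<^sub>1 * a - s\<^sub>2 * b) * Im u + (s\<^sub>1 + s\<^sub>2) * (Y / k))"
  proof -
    have "(s\<^sub>2 - s\<^sub>1) * ((s\<^sub>1 * a - s\<^sub>2 * b) * Im u + (s\<^sub>1 + s\<^sub>2) * (Y / k))
      = (s\<^sub>2 - s\<^sub>1) * (s\<^sub>1 * a - s\<^sub>2 * b) * Im u + k * (Y / k)"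
      unfolding k' by (simp add: algebra_simps)
    also have "\<dots> = (s\<^sub>2 - s\<^sub>1) * (t * Im \<zeta>)" using k unfolding m2 by (simp add: Y_def)
    finally show ?thesis by (rule sym)
  qed
  then have im: "t * Im \<zeta> = (s\<^sub>1 * a - s\<^sub>2 * b) * Im u + (s\<^sub>1 + s\<^sub>2) * (Y / k)"
    by (rule mult_left_cancel[THEN iffD1, rotated]) (use p in simp)
  have "0 < t" using assms s by auto
  then show "z \<in> normalized_numerical_range (polar_form \<omega> u v s\<^sub>1 s\<^sub>2)"
    unfolding z mem_normalized_numerical_range_polar_form[OF \<omega> uv]
    using ab1 tt re im
    by (intro exI[of _ x\<^sub>1] exI[of _ x\<^sub>2] exI[of _ t]) (simp add: x)
qed

lemma ellipse_E_polar_form: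
  assumes "s\<^sub>1 < s\<^sub>2" "s\<^sub>1 \<le> t" "t \<le> s\<^sub>2" "t \<noteq> 0"
  shows "ellipse (E (polar_form \<omega> u v s\<^sub>1 s\<^sub>2) t)"
proof -
  have t: "0 < t" using assms s by auto
  define r where "r = cmod v * sqrt ((t\<^sup>2 - s\<^sub>1\<^sup>2) * (s\<^sub>2\<^sup>2 - t\<^sup>2))"
  have n: "0 \<le> (t\<^sup>2 - s\<^sub>1\<^sup>2) * (s\<^sub>2\<^sup>2 - t\<^sup>2)"
    using assms s t by (intro mult_nonneg_nonneg) (simp_all add: power_mono)
  have r: "0 \<le> r" "r\<^sup>2 = (cmod v)\<^sup>2 * ((t\<^sup>2 - s\<^sub>1\<^sup>2) * (s\<^sub>2\<^sup>2 - t\<^sup>2))"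
    using n by (simp_all add: r_def power_mult_distrib)
  have "E (polar_form \<omega> u v s\<^sub>1 s\<^sub>2) t = {\<omega> * \<zeta> | \<zeta>. \<omega> * \<zeta> \<in> E (polar_form \<omega> u v s\<^sub>1 s\<^sub>2) t}"
    by (rule set_eq_rotated[OF \<omega>])
  also have "\<dots> = {\<omega> * \<zeta> | \<zeta>. ((s\<^sub>1 + s\<^sub>2) * t * Re \<zeta> - (t\<^sup>2 + s\<^sub>1 * s\<^sub>2) * Re u)\<^sup>2
     + ((s\<^sub>2 - s\<^sub>1) * t * Im \<zeta> - (s\<^sub>1 * s\<^sub>2 - t\<^sup>2) * Im u)\<^sup>2 = r\<^sup>2}"
    unfolding mem_E_polar_form r(2) by (simp only: mult.assoc)
  finally show ?thesis
    using ellipse_rotated_axis_parallel[OF _ _ r(1), of "(s\<^sub>1 + s\<^sub>2) * t" "(s\<^sub>2 - s\<^sub>1) * t"] assms s t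
    by simp
qed

end

section \<open>Equal singular values\<close>

context
  fixes \<omega> u v :: complex and s :: real
  assumes \<omega>: "cmod \<omega> = 1" and uv: "(cmod u)\<^sup>2 + (cmod v)\<^sup>2 = 1" and s: "0 < s"
begin

text \<open>Now the second square and the right-hand side of the equation of \<open>E\<close> both vanish,
  and only the line \<open>Re \<zeta> = Re u\<close> is left.\<close>
lemma E_polar_form_equal:
  "E (polar_form \<omega> u v s s) s \<inter> cball 0 1 =
     {\<omega> * \<zeta> | \<zeta>. Re \<zeta> = Re u \<and> \<bar>Im \<zeta>\<bar> \<le> sqrt (1 - (Re u)\<^sup>2)}"
proof -
  have "\<omega> * \<zeta> \<in> E (polar_form \<omega> u v s s) s \<inter> cball 0 1 \<longleftrightarrow>
      Re \<zeta> = Re u \<and> \<bar>Im \<zeta>\<bar> \<le> sqrt (1 - (Re u)\<^sup>2)" for \<zeta>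
  proof -
    have "\<omega> * \<zeta> \<in> E (polar_form \<omega> u v s s) s \<longleftrightarrow> (2 * s\<^sup>2 * (Re \<zeta> - Re u))\<^sup>2 = 0"
      using mem_E_polar_form[OF \<omega> uv, of s s \<zeta> s] s by (simp add: power2_eq_square algebra_simps)
    also have "\<dots> \<longleftrightarrow> Re \<zeta> = Re u" using s by simp
    finally have 1: "\<omega> * \<zeta> \<in> E (polar_form \<omega> u v s s) s \<longleftrightarrow> Re \<zeta> = Re u" .
    have "\<omega> * \<zeta> \<in> cball 0 1 \<longleftrightarrow> (Re \<zeta>)\<^sup>2 + (Im \<zeta>)\<^sup>2 \<le> 1"
      by (simp add: norm_mult \<omega> del: complex_norm) (simp add: cmod_def)
    also have "\<dots> \<longleftrightarrow> (Im \<zeta>)\<^sup>2 \<le> 1 - (Re \<zeta>)\<^sup>2" by auto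
    also have "\<dots> \<longleftrightarrow> \<bar>Im \<zeta>\<bar> \<le> sqrt (1 - (Re \<zeta>)\<^sup>2)"
      by (metis real_sqrt_abs real_sqrt_le_iff)
    finally show ?thesis using 1 by auto
  qed
  then show ?thesis
    using set_eq_rotated[OF \<omega>, of "E (polar_form \<omega> u v s s) s \<inter> cball 0 1"] by simp
qed

lemma ellipse_E_polar_form_equal: "ellipse (E (polar_form \<omega> u v s s) s \<inter> cball 0 1)"
proof -
  have "(Re u)\<^sup>2 \<le> 1" using uv unfolding cmod_power2 by (smt (verit) zero_le_power2)
  then show ?thesis
    unfolding E_polar_form_equal by (intro ellipse_rotated_vertical_segment) simp
qed

text \<open>For \<open>x\<^sub>1 = \<i> cos \<phi> cis (- \<alpha>)\<close> and \<open>x\<^sub>2 = sin \<phi>\<close> with \<open>\<alpha>\<close> the argument of \<open>v\<close>, the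
  imaginary part of \<open>\<zeta>\<close> is \<open>cos (2\<phi>) Im u + sin (2\<phi>) |v|\<close>.  This is a sinusoid in \<open>\<phi>\<close> of amplitude
  \<open>sqrt ((Im u)\<^sup>2 + |v|\<^sup>2) = sqrt (1 - (Re u)\<^sup>2)\<close>, so it covers the whole segment.\<close>
lemma E_subset_normalized_numerical_range_polar_form_equal:
  "E (polar_form \<omega> u v s s) s \<inter> cball 0 1 \<subseteq> normalized_numerical_range (polar_form \<omega> u v s s)"
proof
  fix z assume "z \<in> E (polar_form \<omega> u v s s) s \<inter> cball 0 1"
  then obtain \<zeta> where z: "z = \<omega> * \<zeta>" and re: "Re \<zeta> = Re u"
    and im: "\<bar>Im \<zeta>\<bar> \<le> sqrt (1 - (Re u)\<^sup>2)"
    unfolding E_polar_form_equal by blast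
  define w where "w = Complex (Im u) (cmod v)"
  define R where "R = cmod w"
  have w: "Im u = R * cos (Arg w)" "cmod v = R * sin (Arg w)"
    using rcis_cmod_Arg[of w] by (metis Re_rcis Im_rcis complex.sel R_def w_def)+
  have "R = sqrt (1 - (Re u)\<^sup>2)"
    using uv by (simp add: R_def w_def cmod_def)
  then have imR: "\<bar>Im \<zeta>\<bar> \<le> R" using im by simp
  \<comment> \<open>If \<open>R = 0\<close> then \<open>Im \<zeta> = 0\<close> as well, and the value \<open>Im \<zeta> / R = 0\<close> still serves.\<close>
  define \<gamma> where "\<gamma> = arccos (Im \<zeta> / R)"
  have "\<bar>Im \<zeta> / R\<bar> \<le> 1" using imR by (auto simp: divide_le_eq_1)
  then have "cos \<gamma> = Im \<zeta> / R" unfolding \<gamma>_def by (rule cos_arccos_abs)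
  then have \<gamma>: "R * cos \<gamma> = Im \<zeta>" using imR by auto
  define \<phi> where "\<phi> = (Arg w + \<gamma>) / 2"
  define x\<^sub>1 where "x\<^sub>1 = of_real (cos \<phi>) * (\<i> * cis (- Arg v))"
  define x\<^sub>2 where "x\<^sub>2 = complex_of_real (sin \<phi>)"
  have c: "(cmod x\<^sub>1)\<^sup>2 = (cos \<phi>)\<^sup>2" "(cmod x\<^sub>2)\<^sup>2 = (sin \<phi>)\<^sup>2"
    by (simp_all add: x\<^sub>1_def x\<^sub>2_def norm_mult)
  have "v * cis (- Arg v) = of_real (cmod v)"
    using rcis_cmod_Arg[of v] by (metis cis_cnj cis_mult cis_zero mult.assoc mult.right_neutral rcis_def add.right_inverse)
  then have g: "v * x\<^sub>1 * cnj x\<^sub>2 = \<i> * of_real (cmod v * cos \<phi> * sin \<phi>)"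
    unfolding x\<^sub>1_def x\<^sub>2_def by (simp add: mult_ac)
  have "Im \<zeta> = R * cos (2 * \<phi> - Arg w)" using \<gamma> by (simp add: \<phi>_def add_divide_distrib)
  also have "\<dots> = cos (2 * \<phi>) * Im u + sin (2 * \<phi>) * cmod v"
    unfolding w by (simp add: cos_diff algebra_simps)
  finally have im': "Im \<zeta> = ((cos \<phi>)\<^sup>2 - (sin \<phi>)\<^sup>2) * Im u + 2 * (cmod v * cos \<phi> * sin \<phi>)"
    by (simp add: cos_double sin_double)
  have 1: "(cos \<phi>)\<^sup>2 + (sin \<phi>)\<^sup>2 = 1" by simp
  have "s\<^sup>2 = s\<^sup>2 * (cos \<phi>)\<^sup>2 + s\<^sup>2 * (sin \<phi>)\<^sup>2"
    "s * Re \<zeta> = (s * (cos \<phi>)\<^sup>2 + s * (sin \<phi>)\<^sup>2) * Re u"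
    "s * Im \<zeta> = (s * (cos \<phi>)\<^sup>2 - s * (sin \<phi>)\<^sup>2) * Im u + (s + s) * (cmod v * cos \<phi> * sin \<phi>)"
    unfolding re im' distrib_left[symmetric] 1 by (simp_all add: algebra_simps)
  then show "z \<in> normalized_numerical_range (polar_form \<omega> u v s s)"
    unfolding z mem_normalized_numerical_range_polar_form[OF \<omega> uv]
    using s 1 by (intro exI[of _ x\<^sub>1] exI[of _ x\<^sub>2] exI[of _ s]) (simp add: c g)
qed

end

section \<open>The normalized numerical range as a union of ellipses\<close>

theorem proposition3p2:
  fixes A :: "complex^2^2" and \<sigma>\<^sub>1 \<sigma>\<^sub>2 :: real
  assumes "A \<noteq> 0"
    and "has_singular_values A {#\<sigma>\<^sub>1, \<sigma>\<^sub>2#}"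
    and "\<sigma>\<^sub>1 \<le> \<sigma>\<^sub>2"
  shows "(\<sigma>\<^sub>1 < \<sigma>\<^sub>2 \<longrightarrow>
            (\<forall>t. \<sigma>\<^sub>1 \<le> t \<and> t \<le> \<sigma>\<^sub>2 \<and> t \<noteq> 0 \<longrightarrow> ellipse (E A t)) \<and>
            normalized_numerical_range A = (\<Union>t\<in>{t. \<sigma>\<^sub>1 \<le> t \<and> t \<le> \<sigma>\<^sub>2 \<and> t \<noteq> 0}. E A t)) \<and>
         (\<sigma>\<^sub>1 = \<sigma>\<^sub>2 \<longrightarrow>
            (\<forall>t. \<sigma>\<^sub>1 \<le> t \<and> t \<le> \<sigma>\<^sub>2 \<and> t \<noteq> 0 \<longrightarrow> ellipse (E A t \<inter> cball 0 1)) \<and>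
            normalized_numerical_range A =
              (\<Union>t\<in>{t. \<sigma>\<^sub>1 \<le> t \<and> t \<le> \<sigma>\<^sub>2 \<and> t \<noteq> 0}. E A t \<inter> cball 0 1))"
proof -
  have s2: "0 < \<sigma>\<^sub>2" using larger_singular_value_pos[OF assms(2,3,1)] .
  have s1: "0 \<le> \<sigma>\<^sub>1" using assms(2) by (simp add: has_singular_values_def)
  obtain V \<omega> u v where V: "adj V ** V = mat 1" and \<omega>: "cmod \<omega> = 1"
    and uv: "(cmod u)\<^sup>2 + (cmod v)\<^sup>2 = 1"
    and B: "adj V ** A ** V = polar_form \<omega> u v \<sigma>\<^sub>1 \<sigma>\<^sub>2"
    using unitarily_similar_to_polar_form[OF assms(2) s2] .
  define B where "B = polar_form \<omega> u v \<sigma>\<^sub>1 \<sigma>\<^sub>2"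
  have E: "E A = E B" and N: "normalized_numerical_range A = normalized_numerical_range B"
    using E_unitary_similar[OF V, of A] normalized_numerical_range_unitary_similar[OF V, of A] B
    by (simp_all add: B_def)
  have sub: "normalized_numerical_range B \<subseteq> (\<Union>t\<in>{t. \<sigma>\<^sub>1 \<le> t \<and> t \<le> \<sigma>\<^sub>2 \<and> t \<noteq> 0}. E B t)"
    using normalized_numerical_range_polar_form_subset[OF \<omega> uv s1 assms(3)] unfolding B_def by blast
  show ?thesis
  proof (intro conjI impI)
    assume lt: "\<sigma>\<^sub>1 < \<sigma>\<^sub>2"
    show "\<forall>t. \<sigma>\<^sub>1 \<le> t \<and> t \<le> \<sigma>\<^sub>2 \<and> t \<noteq> 0 \<longrightarrow> ellipse (E A t)"
      using ellipse_E_polar_form[OF \<omega> uv s1 assms(3) lt] unfolding E B_def by blast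
    show "normalized_numerical_range A = (\<Union>t\<in>{t. \<sigma>\<^sub>1 \<le> t \<and> t \<le> \<sigma>\<^sub>2 \<and> t \<noteq> 0}. E A t)"
      using sub E_subset_normalized_numerical_range_polar_form[OF \<omega> uv s1 assms(3) lt]
      unfolding E N B_def by blast
  next
    assume eq: "\<sigma>\<^sub>1 = \<sigma>\<^sub>2"
    have Bs: "B = polar_form \<omega> u v \<sigma>\<^sub>2 \<sigma>\<^sub>2" by (simp add: B_def eq)
    have t: "{t. \<sigma>\<^sub>1 \<le> t \<and> t \<le> \<sigma>\<^sub>2 \<and> t \<noteq> 0} = {\<sigma>\<^sub>2}" using s2 eq by auto
    show "\<forall>t. \<sigma>\<^sub>1 \<le> t \<and> t \<le> \<sigma>\<^sub>2 \<and> t \<noteq> 0 \<longrightarrow> ellipse (E A t \<inter> cball 0 1)"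
      using ellipse_E_polar_form_equal[OF \<omega> uv s2] eq unfolding E Bs by (metis order_antisym)
    show "normalized_numerical_range A =
        (\<Union>t\<in>{t. \<sigma>\<^sub>1 \<le> t \<and> t \<le> \<sigma>\<^sub>2 \<and> t \<noteq> 0}. E A t \<inter> cball 0 1)"
      using sub normalized_numerical_range_subset_cball[of B]
        E_subset_normalized_numerical_range_polar_form_equal[OF \<omega> uv s2]
      unfolding E N t Bs by auto
  qed
qed

end
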